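(* Let $R$ be a finite noncommutative ring and let $r\in K(R)$. Then $\Gamma_R^r$ is not a regular graph.
   Context: Rings are associative and not assumed to have a unity. $[x,y]:=xy-yx$ and $K(R):=\{[x,y]:x,y\in R\}$. The $r$-noncommuting graph $\Gamma_R^r$ is the simple undirected graph with vertex set $R$ in which two distinct vertices $x,y$ are adjacent if and only if $[x,y]\neq r$ and $[x,y]\neq -r$. *)

theory Defs
  imports "Graph_Theory.Pair_Digraph"
begin

text \<open>
  The type class \<^class>\<open>ring\<close> is exactly the class of associative rings in which a unity is
  not required.
\<close>

definition commutator :: "'a::ring \<Rightarrow> 'a \<Rightarrow> 'a" where
  "commutator x y = x * y - y * x"

text \<open>
  The paper's \<open>K(R)\<close>: only the set of commutators itself, not the additive subgroup or the
  ideal generated by it.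
\<close>

definition commutators :: "'a::ring set" where
  "commutators = {commutator x y | x y. True}"

text \<open>
  In \<^theory>\<open>Graph_Theory.Digraph\<close>, a simple undirected graph is a loopfree symmetric digraph without
  parallel arcs: an edge between \<open>x\<close> and \<open>y\<close> is the pair of arcs \<open>(x, y)\<close>, \<open>(y, x)\<close>.
\<close>

definition noncommuting_graph :: "'a::ring \<Rightarrow> 'a pair_pre_digraph" where
  "noncommuting_graph r =
     \<lparr> pverts = UNIV,
       parcs = {(x, y). x \<noteq> y \<and> commutator x y \<noteq> r \<and> commutator x y \<noteq> - r} \<rparr>"

lemma commutator_swap: "commutator y x = - commutator x (y :: 'a::ring)"
  by (simp add: commutator_def)

lemma pair_graph_noncommuting_graph:
  fixes r :: "'a::{ring, finite}"
  shows "pair_graph (noncommuting_graph r)"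
proof unfold_locales
  show "symmetric (with_proj (noncommuting_graph r))"
    unfolding symmetric_def with_proj_simps
  proof (rule symI)
    fix x y
    assume "(x, y) \<in> parcs (noncommuting_graph r)"
    then show "(y, x) \<in> parcs (noncommuting_graph r)"
      by (auto simp: noncommuting_graph_def commutator_swap[of y x] minus_equation_iff)
  qed
qed (auto simp: noncommuting_graph_def)

text \<open>
  On symmetric digraphs the out-degree of a vertex is the number of its neighbours, i.e. its
  degree in the undirected graph. The definition is meant for finite graphs only, since
  \<^const>\<open>card\<close> is \<open>0\<close> on infinite sets.
\<close>

definition regular_graph :: "('a, 'b) pre_digraph \<Rightarrow> bool" where
  "regular_graph G \<longleftrightarrow> (\<exists>k. \<forall>v \<in> verts G. out_degree G v = k)"

end

(* The vertex 0 commutes with every element. If r = 0 it is isolated, although a noncommuting pair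
   gives an edge; if r = [x, y] is nonzero, then 0 is adjacent to all other vertices, but x is not
   adjacent to y. *)

theory Submission
  imports Defs
begin

text \<open>The injection \<open>Pair v\<close> maps the neighbours of \<open>v\<close> onto the
  arcs leaving \<open>v\<close>.\<close>

lemma out_degree_noncommuting_graph:
  "out_degree (with_proj (noncommuting_graph r)) v =
     card {w. v \<noteq> w \<and> commutator v w \<noteq> r \<and> commutator v w \<noteq> - r}"
    (is "_ = card ?N")
proof -
  have "out_arcs (with_proj (noncommuting_graph r)) v = Pair v ` ?N"
    by (auto simp: out_arcs_def noncommuting_graph_def)
  then show ?thesis
    by (simp add: out_degree_def card_image inj_on_def)
qed

theorem proposition2p6:
  fixes r :: "'a::{ring, finite}"
  assumes noncommutative: "\<exists>x y :: 'a. x * y \<noteq> y * x"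
    and "r \<in> commutators"
  shows "\<not> regular_graph (with_proj (noncommuting_graph r))"
proof
  define N where "N v = {w. v \<noteq> w \<and> commutator v w \<noteq> r \<and> commutator v w \<noteq> - r}" for v
  assume "regular_graph (with_proj (noncommuting_graph r))"
  then have regular: "card (N v) = card (N w)" for v w
    unfolding regular_graph_def out_degree_noncommuting_graph N_def
    by (auto simp: noncommuting_graph_def)
  have commutator_0: "commutator 0 w = 0" for w :: 'a
    by (simp add: commutator_def)
  show False
  proof (cases "r = 0")
    case True
    obtain x y :: 'a where "x * y \<noteq> y * x"
      using noncommutative by blast
    then have "y \<in> N x"
      using True by (auto simp: N_def commutator_def)
    moreover have "N 0 = {}"
      using True by (simp add: N_def commutator_0)
    \<comment> \<open>As the type is finite, the nonempty set \<open>N x\<close> has nonzero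
      cardinality.\<close>
    ultimately show False
      using regular[of x 0] by auto
  next
    case False
    obtain x y where r: "r = commutator x y"
      using assms(2) by (auto simp: commutators_def)
    have "x \<noteq> y"
      using False r by (auto simp: commutator_def)
    have "N 0 = - {0}"
      using False by (auto simp: N_def commutator_0)
    \<comment> \<open>Complements of singletons have equal size; passing from \<open>0\<close> to
      \<open>x\<close> makes the count comparable with \<open>N x\<close> by inclusion.\<close>
    then have "card (N 0) = card (- {x})"
      by (simp add: Compl_eq_Diff_UNIV card_Diff_singleton)
    \<comment> \<open>The inclusion is strict because of \<open>y\<close>: it differs from
      \<open>x\<close>, but \<open>commutator x y = r\<close> keeps it out of
      \<open>N x\<close>.\<close>
    moreover have "N x \<subset> - {x}"
      using \<open>x \<noteq> y\<close> r by (auto simp: N_def)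
    then have "card (N x) < card (- {x})"
      by (intro psubset_card_mono) auto
    ultimately show False
      using regular[of 0 x] by simp
  qed
qed

end
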